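(* Let $\mathcal{U}$ be an $M$-dimensional subspace of $\mathcal{C}[-1,1]$ consisting of polynomials of degree at most $d$. Let $(u_1,\ldots,u_M)$ be a basis for $\mathcal{U}$, whose elements have the Chebyshev expansions $$ u_m = \sum_{k=0}^d U_{k,m} T_k, \qquad m \in \{1,\ldots,M\}. $$ For an integer $S > d$ and for points $\theta_1,\ldots,\theta_L \in [0,\pi]$, one has $$ \lambda(\mathcal{U}) \;\ge\; \inf \; \max_{1\le \ell \le L} \left( z_{\ell,0}^+ + z_{\ell,0}^- \right), $$ where the infimum is taken over all vectors $y_1^\pm,\ldots,y_M^\pm, z_1^\pm,\ldots,z_L^\pm \in \mathbb{R}^S$, with entries indexed from $0$ to $S-1$, subject to the constraints $$ \sum_{k=0}^d U_{k,m'}\,(y^+_{m,k} - y^-_{m,k}) = \delta_{m,m'}, \quad m,m' \in \{1,\ldots,M\}, $$ $$ \sum_{m=1}^M u_m(\cos(\theta_\ell))\,(y_m^+ - y_m^-) = z_\ell^+ - z_\ell^-, \quad \ell \in \{1,\ldots,L\}, $$ $$ \mathrm{Toep}_S(y_m^+) \succeq 0, \quad \mathrm{Toep}_S(y_m^-) \succeq 0, \quad m \in \{1,\ldots,M\}, $$ $$ \mathrm{Toep}_S(z_\ell^+) \succeq 0, \quad \mathrm{Toep}_S(z_\ell^-) \succeq 0, \quad \ell \in \{1,\ldots,L\}. $$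
   Context: $\mathcal{C}[-1,1]$ is the space of real-valued continuous functions on $[-1,1]$ with the norm $\|f\|_\infty = \max_{x\in[-1,1]}|f(x)|$. A projection from $\mathcal{C}[-1,1]$ onto a finite-dimensional subspace $\mathcal{U}$ is a linear map $P$ from $\mathcal{C}[-1,1]$ onto $\mathcal{U}$ such that $P(u)=u$ for all $u\in\mathcal{U}$; its norm is $\|P\|_{\infty\to\infty} = \max_{\|f\|_\infty\le 1}\|P(f)\|_\infty$. The projection constant of $\mathcal{U}$ (relative to $\mathcal{C}[-1,1]$) is $\lambda(\mathcal{U}) := \min_P \|P\|_{\infty\to\infty}$, the minimum being over all (bounded) projections $P$ from $\mathcal{C}[-1,1]$ onto $\mathcal{U}$. $T_k$ is the Chebyshev polynomial of the first kind of degree $k$, i.e. $T_k(\cos\theta)=\cos(k\theta)$. For $y=(y_0,\ldots,y_{S-1})\in\mathbb{R}^S$, $\mathrm{Toep}_S(y)$ is the symmetric $S\times S$ Toeplitz matrix whose $(i,j)$ entry is $y_{|i-j|}$. The notation $A \succeq 0$ means that the symmetric matrix $A$ is positive semidefinite. $\delta_{m,m'}$ is the Kronecker delta. The entries of $y_m^\pm$ and $z_\ell^\pm$ are denoted $y_{m,k}^\pm$ and $z_{\ell,k}^\pm$, $k=0,\ldots,S-1$. *)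

theory Defs
  imports
    "HOL-Analysis.Bounded_Continuous_Function"
    "HOL-Analysis.Operator_Norm"
    "HOL-Library.Extended_Real"
    "HOL-Computational_Algebra.Polynomial"
    "Jordan_Normal_Form.Matrix"
begin

typedef cdomain = "{-1..1::real}"
  morphisms real_of_cdomain cdomain_of_real
  by (rule exI[of _ 0]) simp

instantiation cdomain :: metric_space
begin

definition dist_cdomain :: "cdomain \<Rightarrow> cdomain \<Rightarrow> real"
  where "dist_cdomain x y = dist (real_of_cdomain x) (real_of_cdomain y)"

definition uniformity_cdomain :: "(cdomain \<times> cdomain) filter"
  where "uniformity_cdomain = (INF e\<in>{0 <..}. principal {(x, y). dist x y < e})"

definition open_cdomain :: "cdomain set \<Rightarrow> bool"
  where "open_cdomain S = (\<forall>x\<in>S. \<forall>\<^sub>F (x', y) in uniformity. x' = x \<longrightarrow> y \<in> S)"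

instance
proof
  fix x y z :: cdomain
  show "dist x y = 0 \<longleftrightarrow> x = y"
    by (simp add: dist_cdomain_def real_of_cdomain_inject)
  show "dist x y \<le> dist x z + dist y z"
    unfolding dist_cdomain_def by (rule dist_triangle2)
qed (simp_all add: uniformity_cdomain_def open_cdomain_def)

end

text \<open>
  Since the domain is compact, every continuous function on it is bounded, so that the bounded
  continuous functions (with the library's supremum norm) are exactly \<open>C[-1,1]\<close>; the lemmas
  \<open>ceval_surj\<close>, \<open>ceval_eqI\<close> and \<open>norm_eq_Sup_ceval\<close> below spell this out.
\<close>

type_synonym cfun = "cdomain \<Rightarrow>\<^sub>C real"

definition ceval :: "cfun \<Rightarrow> real \<Rightarrow> real"
  where "ceval f x = apply_bcontfun f (cdomain_of_real x)"

lemma continuous_on_real_of_cdomain: "continuous_on A real_of_cdomain"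
  by (auto simp: continuous_on_iff dist_cdomain_def)

lemma continuous_on_cdomain_of_real: "continuous_on {-1..1} cdomain_of_real"
  by (auto simp: continuous_on_iff dist_cdomain_def cdomain_of_real_inverse)

lemma range_real_of_cdomain: "range real_of_cdomain = {-1..1}"
  by (rule type_definition.Rep_range[OF type_definition_cdomain])

lemma continuous_on_ceval: "continuous_on {-1..1} (ceval f)"
  unfolding ceval_def
  by (rule continuous_on_compose2[OF continuous_on_apply_bcontfun[of UNIV]
        continuous_on_cdomain_of_real]) simp

lemma ceval_surj:
  assumes "continuous_on {-1..1} g"
  shows "\<exists>f. \<forall>x\<in>{-1..1}. ceval f x = g x"
proof -
  have *: "range (\<lambda>x. g (real_of_cdomain x)) = g ` {-1..1}"
    by (simp flip: range_real_of_cdomain add: image_image)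
  have "continuous_on UNIV (\<lambda>x. g (real_of_cdomain x))"
    by (rule continuous_on_compose2[OF assms continuous_on_real_of_cdomain])
      (simp add: range_real_of_cdomain)
  moreover have "bounded (range (\<lambda>x. g (real_of_cdomain x)))"
    unfolding * by (intro compact_imp_bounded compact_continuous_image assms compact_Icc)
  ultimately have "(\<lambda>x. g (real_of_cdomain x)) \<in> bcontfun"
    by (simp add: bcontfun_def)
  then have "\<forall>x\<in>{-1..1}. ceval (Bcontfun (\<lambda>x. g (real_of_cdomain x))) x = g x"
    by (simp add: ceval_def Bcontfun_inverse cdomain_of_real_inverse)
  then show ?thesis ..
qed

lemma ceval_eqI:
  assumes "\<And>x. x \<in> {-1..1} \<Longrightarrow> ceval f x = ceval g x"
  shows "f = g"
proof (rule bcontfun_eqI)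
  fix x
  show "apply_bcontfun f x = apply_bcontfun g x"
    using assms[OF real_of_cdomain] by (simp add: ceval_def real_of_cdomain_inverse)
qed

lemma norm_eq_Sup_ceval: "norm f = (SUP x\<in>{-1..1}. \<bar>ceval f x\<bar>)"
proof -
  have "norm f = (SUP x. \<bar>apply_bcontfun f x\<bar>)"
    by (simp add: norm_bcontfun_def dist_bcontfun_def zero_bcontfun.rep_eq)
  also have "\<dots> = (SUP x\<in>range real_of_cdomain. \<bar>ceval f x\<bar>)"
    by (simp add: ceval_def image_image real_of_cdomain_inverse)
  finally show ?thesis by (simp add: range_real_of_cdomain)
qed

definition projection_onto :: "cfun set \<Rightarrow> (cfun \<Rightarrow> cfun) \<Rightarrow> bool"
  where "projection_onto \<U> P \<longleftrightarrow>
    bounded_linear P \<and> range P = \<U> \<and> (\<forall>u\<in>\<U>. P u = u)"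

text \<open>
  The infimum is taken in the reals, which is meaningful for finite-dimensional \<open>\<U>\<close>: bounded
  projections then exist, and the infimum is attained, so that it is the minimum.
\<close>

definition projection_constant :: "cfun set \<Rightarrow> real"
  where "projection_constant \<U> = (INF P\<in>{P. projection_onto \<U> P}. onorm P)"

fun chebyshev :: "nat \<Rightarrow> real poly" where
  "chebyshev 0 = 1"
| "chebyshev (Suc 0) = [:0, 1:]"
| "chebyshev (Suc (Suc k)) = [:0, 2:] * chebyshev (Suc k) - chebyshev k"

lemma poly_chebyshev_cos: "poly (chebyshev k) (cos \<theta>) = cos (real k * \<theta>)"
proof (induction k rule: chebyshev.induct)
  case (3 k)
  have "cos ((real k + 1) * \<theta> + \<theta>) + cos ((real k + 1) * \<theta> - \<theta>)
      = 2 * cos \<theta> * cos ((real k + 1) * \<theta>)"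
    by (simp add: cos_add cos_diff)
  then show ?case using 3 by (simp add: algebra_simps)
qed simp_all

lemma chebyshev_eqI:
  assumes "\<And>\<theta>. poly p (cos \<theta>) = cos (real k * \<theta>)"
  shows "p = chebyshev k"
proof (rule ccontr)
  assume "p \<noteq> chebyshev k"
  then have "finite {x. poly (p - chebyshev k) x = 0}"
    by (intro poly_roots_finite) simp
  moreover have "{-1..1} \<subseteq> {x. poly (p - chebyshev k) x = 0}"
  proof
    fix x :: real
    assume "x \<in> {-1..1}"
    then have "x = cos (arccos x)" by (simp add: cos_arccos)
    then show "x \<in> {x. poly (p - chebyshev k) x = 0}"
      by (metis (mono_tags, lifting) assms poly_chebyshev_cos diff_self mem_Collect_eq poly_diff)
  qed
  ultimately have "finite {-1..1::real}" by (rule rev_finite_subset)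
  then show False by (simp add: infinite_Icc)
qed

definition toep :: "nat \<Rightarrow> real Matrix.vec \<Rightarrow> real mat"
  where "toep S y = mat S S (\<lambda>(i, j). y $ nat \<bar>int i - int j\<bar>)"

definition psd :: "real mat \<Rightarrow> bool"
  where "psd A \<longleftrightarrow> square_mat A \<and> transpose_mat A = A \<and>
    (\<forall>x \<in> carrier_vec (dim_row A). x \<bullet> (A *\<^sub>v x) \<ge> 0)"

end

theory Submission
  imports Defs
begin

unbundle no vec_syntax \<comment> \<open>its \<open>$\<close> clashes with the vector indexing of \<open>Jordan_Normal_Form\<close>\<close>

text \<open>
  Let \<open>P\<close> be a projection onto \<open>\<U>\<close>. Writing \<open>P f = (\<Sum>m. \<lambda>\<^sub>m f * u\<^sub>m)\<close>, each coordinate functional \<open>\<lambda>\<^sub>m\<close>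
  and each point evaluation \<open>f \<mapsto> P f (cos \<theta>\<^sub>l)\<close> is a bounded functional, hence a difference of two
  positive ones. The values of these positive functionals on \<open>T\<^sub>0, \<dots>, T\<^bsub>S-1\<^esub>\<close> are feasible: trigonometric
  moments of a positive functional have a positive semidefinite Toeplitz matrix, biorthogonality is
  \<open>P u\<^sub>m = u\<^sub>m\<close>, and the second constraint is the expansion of \<open>P T\<^sub>k\<close> at \<open>cos \<theta>\<^sub>l\<close>. Because \<open>T\<^sub>0 = 1\<close>,
  the objective is the total mass of the evaluation functionals, which is at most \<open>onorm P\<close>.
  The Jordan decomposition is obtained directly by Riesz's formula, without measures.
\<close>

section \<open>Jordan decomposition of bounded functionals\<close>

abbreviation nonneg :: "('a::topological_space \<Rightarrow>\<^sub>C real) \<Rightarrow> bool"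
  where "nonneg f \<equiv> \<forall>x. apply_bcontfun f x \<ge> 0"

text \<open>Every \<open>f\<close> is a difference of nonnegative functions,
  \<open>f = (f + c f) - c f\<close> with the constant function \<open>c f\<close> of value
  \<open>norm f\<close>, so the value of a linear extension at \<open>f\<close> is forced.\<close>

lemma additive_on_cone_extends_linear:
  fixes p :: "('a::topological_space \<Rightarrow>\<^sub>C real) \<Rightarrow> real"
  assumes add: "\<And>f g. nonneg f \<Longrightarrow> nonneg g \<Longrightarrow> p (f + g) = p f + p g"
    and scale: "\<And>f r. nonneg f \<Longrightarrow> r > 0 \<Longrightarrow> p (r *\<^sub>R f) = r * p f"
  obtains q where "linear q" "\<And>f. nonneg f \<Longrightarrow> q f = p f"
proof -
  define c :: "('a \<Rightarrow>\<^sub>C real) \<Rightarrow> ('a \<Rightarrow>\<^sub>C real)" where "c f = const_bcontfun (norm f)" for f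
  define q where "q f = p (f + c f) - p (c f)" for f
  have c: "nonneg (c f)" for f
    by (simp add: c_def const_bcontfun.rep_eq)
  have fc: "nonneg (f + c f)" for f
  proof
    fix x
    have "\<bar>f x\<bar> \<le> norm f" using norm_bounded[of f x] by simp
    then show "(f + c f) x \<ge> 0" by (simp add: c_def const_bcontfun.rep_eq)
  qed
  \<comment> \<open>Well-definedness: by additivity every decomposition into nonnegative functions
    yields the same value. Linearity follows by choosing convenient decompositions.\<close>
  have q_diff: "q f = p a - p b" if "f + b = a" "nonneg a" "nonneg b" for f a b
  proof -
    have "(f + c f) + b = a + c f" using that(1) by (simp add: algebra_simps)
    then have "p (f + c f) + p b = p a + p (c f)"
      using add[OF fc that(3)] add[OF that(2) c] by metis
    then show ?thesis by (simp add: q_def)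
  qed
  have p0: "p 0 = 0" using add[of 0 0] by simp
  have "q f = p f" if "nonneg f" for f
    using q_diff[of f 0 f] that p0 by simp
  moreover have "linear q"
  proof (rule linearI)
    fix f g
    have "q (f + g) = p ((f + c f) + (g + c g)) - p (c f + c g)"
    proof (rule q_diff)
      show "nonneg ((f + c f) + (g + c g))"
        using fc[of f] fc[of g] by (metis add_nonneg_nonneg plus_bcontfun.rep_eq)
      show "nonneg (c f + c g)" using c by simp
    qed (simp add: algebra_simps)
    then show "q (f + g) = q f + q g"
      by (simp add: add[OF fc fc] add[OF c c] q_def)
  next
    fix r :: real and f
    consider "r = 0" | "r > 0" | "r < 0" by linarith
    then show "q (r *\<^sub>R f) = r *\<^sub>R q f"
    proof cases
      case 1
      then show ?thesis using q_diff[of 0 0 0] by simp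
    next
      case 2
      have "q (r *\<^sub>R f) = p (r *\<^sub>R (f + c f)) - p (r *\<^sub>R c f)"
      proof (rule q_diff)
        show "nonneg (r *\<^sub>R (f + c f))"
          using 2 fc[of f] by (auto simp only: scaleR_bcontfun.rep_eq intro!: scaleR_nonneg_nonneg)
        show "nonneg (r *\<^sub>R c f)" using 2 c by simp
      qed (simp add: algebra_simps)
      then show ?thesis
        by (simp only: scale[OF fc 2] scale[OF c 2]) (simp add: q_def algebra_simps)
    next
      case 3
      then have r: "- r > 0" by simp
      \<comment> \<open>A negative factor swaps the two parts: \<open>f + c f\<close>, scaled by
        \<open>- r\<close>, becomes the subtracted one.\<close>
      have "q (r *\<^sub>R f) = p ((- r) *\<^sub>R c f) - p ((- r) *\<^sub>R (f + c f))"
      proof (rule q_diff)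
        show "nonneg ((- r) *\<^sub>R (f + c f))"
          using r fc[of f] by (auto simp only: scaleR_bcontfun.rep_eq intro!: scaleR_nonneg_nonneg)
        show "nonneg ((- r) *\<^sub>R c f)"
          using r c[of f] by (auto simp only: scaleR_bcontfun.rep_eq intro!: scaleR_nonneg_nonneg)
      qed (simp add: algebra_simps)
      then show ?thesis
        by (simp only: scale[OF fc r] scale[OF c r]) (simp add: q_def algebra_simps)
    qed
  qed
  ultimately show ?thesis using that by blast
qed

lemma bcontfun_min:
  fixes f g :: "'a::topological_space \<Rightarrow>\<^sub>C real"
  obtains h :: "'a \<Rightarrow>\<^sub>C real" where "\<And>x. h x = min (f x) (g x)"
proof -
  have "(\<lambda>x. min (f x) (g x)) \<in> bcontfun"
  proof (rule bcontfun_normI)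
    show "continuous_on UNIV (\<lambda>x. min (f x) (g x))" by (intro continuous_intros) auto
    show "norm (min (f x) (g x)) \<le> norm f + norm g" for x
      using norm_bounded[of f x] norm_bounded[of g x] norm_ge_zero[of f] norm_ge_zero[of g]
      unfolding real_norm_def min_def by auto
  qed
  then have "\<forall>x. Bcontfun (\<lambda>x. min (f x) (g x)) x = min (f x) (g x)"
    by (simp add: Bcontfun_inverse)
  then show ?thesis using that by blast
qed

text \<open>The positive part is the supremum of \<open>\<phi> g\<close> over
  \<open>0 \<le> g \<le> f\<close>, and the negative part is its excess over \<open>\<phi>\<close>.
  Bounding the sum of both values at 1, and not each separately, is what later allows comparison
  with an operator norm.\<close>

lemma jordan_decomposition_functional:
  fixes \<phi> :: "('a::topological_space \<Rightarrow>\<^sub>C real) \<Rightarrow> real"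
  assumes lin: "linear \<phi>" and bnd: "\<And>f. \<bar>\<phi> f\<bar> \<le> C * norm f" and "C \<ge> 0"
  obtains \<phi>p \<phi>m where "linear \<phi>p" "linear \<phi>m"
    "\<And>f. nonneg f \<Longrightarrow> \<phi>p f \<ge> 0" "\<And>f. nonneg f \<Longrightarrow> \<phi>m f \<ge> 0"
    "\<And>f. \<phi> f = \<phi>p f - \<phi>m f"
    "\<phi>p (const_bcontfun 1) + \<phi>m (const_bcontfun 1) \<le> C"
proof -
  define I where "I f = {g :: 'a \<Rightarrow>\<^sub>C real. \<forall>x. 0 \<le> g x \<and> g x \<le> f x}" for f :: "'a \<Rightarrow>\<^sub>C real"
  define p where "p f = (SUP g\<in>I f. \<phi> g)" for f
  \<comment> \<open>A supremum of reals is meaningful only for a set bounded above; here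
    \<open>0 \<le> g \<le> f\<close> forces \<open>norm g \<le> norm f\<close>.\<close>
  have bdd: "bdd_above (\<phi> ` I f)" for f
  proof (rule bdd_aboveI2)
    fix g assume g: "g \<in> I f"
    have "norm g \<le> norm f"
    proof (rule norm_bound)
      fix x
      have "norm (g x) \<le> norm (f x)" using g by (auto simp: I_def intro: order_trans)
      then show "norm (g x) \<le> norm f" using norm_bounded[of f x] by linarith
    qed
    then have "C * norm g \<le> C * norm f" using \<open>C \<ge> 0\<close> by (rule mult_left_mono)
    then show "\<phi> g \<le> C * norm f" using bnd[of g] by linarith
  qed
  have le_p: "\<phi> g \<le> p f" if "g \<in> I f" for f g
    unfolding p_def by (rule cSUP_upper[OF that bdd])
  have ne: "0 \<in> I f" "f \<in> I f" if "nonneg f" for f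
    using that by (auto simp: I_def)
  have p_le: "p f \<le> b" if "nonneg f" "\<And>g. g \<in> I f \<Longrightarrow> \<phi> g \<le> b" for f b
    unfolding p_def using ne[OF that(1)] that(2) by (intro cSUP_least) auto
  have add: "p (f + g) = p f + p g" if f: "nonneg f" and g: "nonneg g" for f g
  proof (rule antisym)
    show "p (f + g) \<le> p f + p g"
    proof (rule p_le)
      show "nonneg (f + g)" using f g by simp
      fix h assume h: "h \<in> I (f + g)"
      \<comment> \<open>Riesz decomposition: \<open>h = min h f + (h - min h f)\<close>.\<close>
      obtain k where k: "\<And>x. apply_bcontfun k x = min (h x) (f x)" using bcontfun_min[of h f] by blast
      have "k \<in> I f" using h f by (auto simp: I_def k)
      moreover have "h - k \<in> I g"
        using h g by (auto simp: I_def k min_def algebra_simps)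
      ultimately have "\<phi> k + \<phi> (h - k) \<le> p f + p g" by (intro add_mono le_p)
      then show "\<phi> h \<le> p f + p g" by (simp add: linear_diff[OF lin])
    qed
    have sum_le: "\<phi> h + \<phi> k \<le> p (f + g)" if "h \<in> I f" "k \<in> I g" for h k
    proof -
      have "h + k \<in> I (f + g)" using that by (auto simp: I_def intro: add_mono)
      then show ?thesis using le_p linear_add[OF lin] by metis
    qed
    \<comment> \<open>The suprema are taken one at a time: first over \<open>I f\<close> with
      \<open>k\<close> fixed, then over \<open>I g\<close>.\<close>
    have "p f \<le> p (f + g) - \<phi> k" if "k \<in> I g" for k
      using sum_le[OF _ that] by (intro p_le[OF f]) (simp add: le_diff_eq)
    then have "p g \<le> p (f + g) - p f"
      by (intro p_le[OF g]) (simp add: le_diff_eq add.commute)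
    then show "p f + p g \<le> p (f + g)" by simp
  qed
  have scale_le: "p (r *\<^sub>R f) \<le> r * p f" if f: "nonneg f" and r: "r > 0" for f r
  proof (rule p_le)
    show "nonneg (r *\<^sub>R f)" using f r by simp
    fix g assume g: "g \<in> I (r *\<^sub>R f)"
    have "inverse r *\<^sub>R g \<in> I f" using g r by (auto simp: I_def field_simps)
    from le_p[OF this] show "\<phi> g \<le> r * p f"
      using r by (simp add: linear_scale[OF lin] field_simps)
  qed
  have scale: "p (r *\<^sub>R f) = r * p f" if f: "nonneg f" and r: "r > 0" for f r
  proof (rule antisym[OF scale_le[OF that]])
    \<comment> \<open>The reverse inequality is \<open>scale_le\<close> for the factor
      \<open>inverse r\<close>, applied to \<open>r *\<^sub>R f\<close>.\<close>
    have "p (inverse r *\<^sub>R (r *\<^sub>R f)) \<le> inverse r * p (r *\<^sub>R f)"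
      using f r by (intro scale_le) auto
    then show "r * p f \<le> p (r *\<^sub>R f)" using r by (simp add: field_simps)
  qed
  obtain q where q: "linear q" "\<And>f. nonneg f \<Longrightarrow> q f = p f"
    using additive_on_cone_extends_linear[of p, OF add scale] by blast
  let ?one = "const_bcontfun 1 :: 'a \<Rightarrow>\<^sub>C real"
  have one: "nonneg ?one" by (simp add: const_bcontfun.rep_eq)
  \<comment> \<open>If \<open>0 \<le> g \<le> 1\<close> then \<open>2g - 1\<close> lies in the unit ball.\<close>
  have "p ?one \<le> (C + \<phi> ?one) / 2"
  proof (rule p_le[OF one])
    fix g assume g: "g \<in> I ?one"
    have "norm (2 *\<^sub>R g - ?one) \<le> 1"
    proof (rule norm_bound)
      fix x
      have "0 \<le> g x" "g x \<le> 1" using g by (auto simp: I_def const_bcontfun.rep_eq)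
      then show "norm ((2 *\<^sub>R g - ?one) x) \<le> 1"
        by (simp add: const_bcontfun.rep_eq abs_le_iff)
    qed
    then have "C * norm (2 *\<^sub>R g - ?one) \<le> C" using \<open>C \<ge> 0\<close> by (simp add: mult_left_le)
    then have "\<phi> (2 *\<^sub>R g - ?one) \<le> C" using bnd[of "2 *\<^sub>R g - ?one"] by linarith
    then show "\<phi> g \<le> (C + \<phi> ?one) / 2"
      by (simp add: linear_diff[OF lin] linear_scale[OF lin])
  qed
  then have norm: "q ?one + (q ?one - \<phi> ?one) \<le> C" using q(2)[OF one] by simp
  show ?thesis
  proof (rule that[of q "\<lambda>f. q f - \<phi> f"])
    show "linear (\<lambda>f. q f - \<phi> f)" using q(1) lin by (rule linear_compose_sub)
    \<comment> \<open>Both positivity claims test the supremum with an extreme element of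
      \<open>I f\<close>: with 0 here, with \<open>f\<close> itself for the negative part.\<close>
    show "q f \<ge> 0" if "nonneg f" for f
      using le_p[OF ne(1)[OF that]] q(2)[OF that] linear_0[OF lin] by simp
    show "q f - \<phi> f \<ge> 0" if "nonneg f" for f
      using le_p[OF ne(2)[OF that]] q(2)[OF that] by simp
  qed (use q norm in auto)
qed

section \<open>Bounded projections and dual functionals\<close>

lemma bounded_linear_apply_bcontfun:
  "bounded_linear (\<lambda>f :: 'a::topological_space \<Rightarrow>\<^sub>C 'b::real_normed_vector. apply_bcontfun f x)"
proof (rule bounded_linear_intro[where K = 1])
  show "norm (apply_bcontfun f x) \<le> norm f * 1" for f :: "'a \<Rightarrow>\<^sub>C 'b"
    using norm_bounded[of f x] by simp
qed simp_all

text \<open>Used twice: to build dual functionals and to show that projections exist. In the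
  induction a vector fixed by the previous projection already lies in the span; any other one costs
  a rank-one correction.\<close>

lemma bounded_projection_onto_span:
  fixes B :: "('a::topological_space \<Rightarrow>\<^sub>C real) set"
  assumes "finite B"
  obtains P where "bounded_linear P" "range P \<subseteq> span B" "\<And>f. f \<in> span B \<Longrightarrow> P f = f"
proof -
  have "\<exists>P. bounded_linear P \<and> range P \<subseteq> span B \<and> (\<forall>f\<in>span B. P f = f)"
    using assms
  proof induction
    case empty
    show ?case by (rule exI[of _ "\<lambda>_. 0"]) (auto simp: bounded_linear_zero)
  next
    case (insert b B)
    then obtain P where P: "bounded_linear P" "range P \<subseteq> span B" "\<And>f. f \<in> span B \<Longrightarrow> P f = f"
      by blast
    show ?case
    proof (cases "P b = b")
      case True
      then have "span (insert b B) = span B" using P(2) by (metis range_subsetD span_redundant)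
      then show ?thesis using P by auto
    next
      case False
      \<comment> \<open>Correct \<open>P\<close> in the direction \<open>e\<close>, which \<open>P\<close> annihilates and the evaluation at \<open>x\<close> detects.\<close>
      define e where "e = b - P b"
      have "e \<noteq> 0" using False by (simp add: e_def)
      then obtain x where x: "e x \<noteq> 0" by (metis bcontfun_eqI zero_bcontfun.rep_eq)
      define Q where "Q f = P f + ((f - P f) x / e x) *\<^sub>R e" for f
      have lin: "bounded_linear Q"
        unfolding Q_def divide_inverse
        by (intro bounded_linear_add P(1) bounded_linear_scaleR_const bounded_linear_mult_const
            bounded_linear_compose[OF bounded_linear_apply_bcontfun]
            bounded_linear_sub bounded_linear_ident)
      have "e \<in> span (insert b B)"
        unfolding e_def using P(2)
        by (intro span_diff) (auto intro: span_base span_mono[THEN subsetD, of B])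
      then have "range Q \<subseteq> span (insert b B)"
        using P(2) unfolding Q_def
        by (auto intro!: span_add span_scale intro: span_mono[THEN subsetD, of B])
      \<comment> \<open>On \<open>B\<close> the correction vanishes because \<open>P\<close> fixes
        \<open>f\<close>; at \<open>b\<close> its coefficient is 1 and it adds exactly
        \<open>b - P b\<close>. Linearity extends this to the span.\<close>
      moreover have "Q f = f" if "f \<in> insert b B" for f
        using that x P(3)[OF span_base] by (auto simp: Q_def e_def)
      then have "\<forall>f\<in>span (insert b B). Q f = f"
        using linear_eq_on_span[OF bounded_linear.linear[OF lin] linear_ident, of "insert b B"]
        by simp
      ultimately show ?thesis using lin by blast
    qed
  qed
  then show ?thesis using that by blast
qed

text \<open>Projecting away the other elements helps: \<open>f - Q f\<close> vanishes on them but,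
  by independence, not at \<open>b\<close>. Evaluating at a point where \<open>b - Q b\<close> is
  nonzero and normalising gives \<open>\<mu>\<close>.\<close>

lemma bounded_dual_functional:
  fixes B :: "('a::topological_space \<Rightarrow>\<^sub>C real) set"
  assumes "finite B" "independent B" "b \<in> B"
  obtains \<mu> where "bounded_linear \<mu>" "\<mu> b = (1::real)" "\<And>c. c \<in> B \<Longrightarrow> c \<noteq> b \<Longrightarrow> \<mu> c = 0"
proof -
  obtain Q where Q: "bounded_linear Q" "range Q \<subseteq> span (B - {b})"
    "\<And>f. f \<in> span (B - {b}) \<Longrightarrow> Q f = f"
    using bounded_projection_onto_span[of "B - {b}"] assms(1) by auto
  have "b \<notin> span (B - {b})" using assms(2,3) by (auto simp: dependent_def)
  then have "b - Q b \<noteq> 0" using Q(2) by auto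
  then obtain x where x: "(b - Q b) x \<noteq> 0" by (metis bcontfun_eqI zero_bcontfun.rep_eq)
  show ?thesis
  proof (rule that[of "\<lambda>f. (f - Q f) x / (b - Q b) x"])
    show "bounded_linear (\<lambda>f. (f - Q f) x / (b - Q b) x)"
      unfolding divide_inverse
      by (intro Q(1) bounded_linear_mult_const bounded_linear_sub bounded_linear_ident
          bounded_linear_compose[OF bounded_linear_apply_bcontfun])
    show "(c - Q c) x / (b - Q b) x = 0" if "c \<in> B" "c \<noteq> b" for c
      using Q(3)[OF span_base, of c] that by simp
  qed (use x in simp)
qed

section \<open>Moments of positive functionals\<close>

text \<open>The addition theorem splits the double sum into two squares; it is the squared modulus
  of the exponential sum with coefficients \<open>x i\<close>.\<close>

lemma toeplitz_cos_sum_nonneg: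
  fixes x :: "nat \<Rightarrow> real"
  shows "(\<Sum>i\<in>A. \<Sum>j\<in>A. x i * x j * cos (real (nat \<bar>int i - int j\<bar>) * t)) \<ge> 0"
proof -
  have cos_dist: "cos (real (nat \<bar>int i - int j\<bar>) * t) = cos (i * t) * cos (j * t) + sin (i * t) * sin (j * t)"
    for i j :: nat
  proof -
    have "real (nat \<bar>int i - int j\<bar>) = \<bar>real i - real j\<bar>" by linarith
    then have "cos (real (nat \<bar>int i - int j\<bar>) * t) = cos (i * t - j * t)"
      by (cases "i \<ge> j") (auto simp: abs_if algebra_simps intro: cos_minus[symmetric, THEN trans])
    then show ?thesis by (simp add: cos_diff)
  qed
  have "(\<Sum>i\<in>A. \<Sum>j\<in>A. x i * x j * cos (real (nat \<bar>int i - int j\<bar>) * t))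
      = (\<Sum>i\<in>A. x i * cos (i * t))\<^sup>2 + (\<Sum>i\<in>A. x i * sin (i * t))\<^sup>2"
    unfolding cos_dist power2_eq_square sum_product sum.distrib[symmetric]
    by (intro sum.cong refl) (simp add: algebra_simps)
  then show ?thesis by simp
qed

text \<open>The quadratic form at \<open>x\<close> equals \<open>q F\<close>, where the value of
  \<open>F\<close> at \<open>cos t\<close> is the double cosine sum; so \<open>F\<close> is
  nonnegative and positivity of \<open>q\<close> applies.\<close>

lemma psd_toep_moments:
  fixes q :: "cfun \<Rightarrow> real" and T :: "nat \<Rightarrow> cfun"
  assumes q: "linear q" and pos: "\<And>f. nonneg f \<Longrightarrow> q f \<ge> 0"
    and T: "\<And>k x. x \<in> {-1..1} \<Longrightarrow> ceval (T k) x = poly (chebyshev k) x"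
  shows "psd (toep S (Matrix.vec S (\<lambda>k. q (T k))))"
proof -
  let ?A = "toep S (Matrix.vec S (\<lambda>k. q (T k)))"
  have A: "dim_row ?A = S" "dim_col ?A = S"
    "\<And>i j. i < S \<Longrightarrow> j < S \<Longrightarrow> ?A $$ (i, j) = q (T (nat \<bar>int i - int j\<bar>))"
    by (auto simp: toep_def)
  have "scalar_prod x (?A *\<^sub>v x) \<ge> 0" if x: "x \<in> carrier_vec S" for x
  proof -
    define F where "F = (\<Sum>i\<in>{0..<S}. \<Sum>j\<in>{0..<S}. (x $ i * x $ j) *\<^sub>R T (nat \<bar>int i - int j\<bar>))"
    have "scalar_prod x (?A *\<^sub>v x) = (\<Sum>i\<in>{0..<S}. x $ i * (\<Sum>j\<in>{0..<S}. ?A $$ (i, j) * x $ j))"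
      using x A(1,2) by (simp add: scalar_prod_def)
    also have "\<dots> = q F"
      unfolding F_def linear_sum[OF q] linear_scale[OF q] sum_distrib_left
      by (intro sum.cong refl) (simp add: A(3))
    also have "q F \<ge> 0"
    proof (rule pos, rule allI)
      fix z
      define t where "t = arccos (real_of_cdomain z)"
      have z: "real_of_cdomain z \<in> {-1..1}" by (rule real_of_cdomain)
      have "apply_bcontfun (T k) z = cos (real k * t)" for k
        using T[OF z, of k] z poly_chebyshev_cos[of k t]
        by (simp add: ceval_def real_of_cdomain_inverse t_def cos_arccos)
      then have "apply_bcontfun F z =
          (\<Sum>i\<in>{0..<S}. \<Sum>j\<in>{0..<S}. x $ i * x $ j * cos (real (nat \<bar>int i - int j\<bar>) * t))"
        unfolding F_def linear_sum[OF bounded_linear.linear[OF bounded_linear_apply_bcontfun]]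
        by simp
      then show "apply_bcontfun F z \<ge> 0" by (simp only: toeplitz_cos_sum_nonneg)
    qed
    finally show ?thesis .
  qed
  moreover have "transpose_mat ?A = ?A"
    by (rule eq_matI) (auto simp: A abs_minus_commute)
  ultimately show ?thesis by (simp add: psd_def A)
qed

section \<open>The semidefinite lower bound for the projection constant\<close>

theorem proposition6:
  fixes \<U> :: "cfun set" and u :: "nat \<Rightarrow> cfun" and U :: "nat \<Rightarrow> nat \<Rightarrow> real"
    and \<theta> :: "nat \<Rightarrow> real" and M d S L :: nat
  assumes "subspace \<U>" and "dim \<U> = M"
    and "\<And>f. f \<in> \<U> \<Longrightarrow> \<exists>p::real poly. degree p \<le> d \<and> (\<forall>x\<in>{-1..1}. ceval f x = poly p x)"
    and "inj_on u {1..M}" and "independent (u ` {1..M})" and "span (u ` {1..M}) = \<U>"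
    and "\<And>m x. m \<in> {1..M} \<Longrightarrow> x \<in> {-1..1} \<Longrightarrow>
           ceval (u m) x = (\<Sum>k=0..d. U k m * poly (chebyshev k) x)"
    and "S > d"
    and "L \<ge> 1" and "\<And>l. l \<in> {1..L} \<Longrightarrow> \<theta> l \<in> {0..pi}"
  shows "ereal (projection_constant \<U>) \<ge>
    Inf {ereal (MAX l\<in>{1..L}. zp l $ 0 + zm l $ 0) | yp ym zp zm :: nat \<Rightarrow> real Matrix.vec.
      (\<forall>m\<in>{1..M}. yp m \<in> carrier_vec S \<and> ym m \<in> carrier_vec S) \<and>
      (\<forall>l\<in>{1..L}. zp l \<in> carrier_vec S \<and> zm l \<in> carrier_vec S) \<and>
      (\<forall>m\<in>{1..M}. \<forall>m'\<in>{1..M}.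
         (\<Sum>k=0..d. U k m' * (yp m $ k - ym m $ k)) = (if m = m' then 1 else 0)) \<and>
      (\<forall>l\<in>{1..L}.
         finsum_vec TYPE(real) S (\<lambda>m. ceval (u m) (cos (\<theta> l)) \<cdot>\<^sub>v (yp m - ym m)) {1..M}
           = zp l - zm l) \<and>
      (\<forall>m\<in>{1..M}. psd (toep S (yp m)) \<and> psd (toep S (ym m))) \<and>
      (\<forall>l\<in>{1..L}. psd (toep S (zp l)) \<and> psd (toep S (zm l)))}"
proof -
  let ?E = "{ereal (MAX l\<in>{1..L}. zp l $ 0 + zm l $ 0) | yp ym zp zm :: nat \<Rightarrow> real Matrix.vec.
      (\<forall>m\<in>{1..M}. yp m \<in> carrier_vec S \<and> ym m \<in> carrier_vec S) \<and>
      (\<forall>l\<in>{1..L}. zp l \<in> carrier_vec S \<and> zm l \<in> carrier_vec S) \<and>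
      (\<forall>m\<in>{1..M}. \<forall>m'\<in>{1..M}.
         (\<Sum>k=0..d. U k m' * (yp m $ k - ym m $ k)) = (if m = m' then 1 else 0)) \<and>
      (\<forall>l\<in>{1..L}.
         finsum_vec TYPE(real) S (\<lambda>m. ceval (u m) (cos (\<theta> l)) \<cdot>\<^sub>v (yp m - ym m)) {1..M}
           = zp l - zm l) \<and>
      (\<forall>m\<in>{1..M}. psd (toep S (yp m)) \<and> psd (toep S (ym m))) \<and>
      (\<forall>l\<in>{1..L}. psd (toep S (zp l)) \<and> psd (toep S (zm l)))}"
  let ?B = "u ` {1..M}"

  \<comment> \<open>Chebyshev polynomials in \<open>C[-1,1]\<close> and moment vectors of
    functionals\<close>
  obtain T where T: "\<And>k x. x \<in> {-1..1} \<Longrightarrow> ceval (T k) x = poly (chebyshev k) x"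
  proof -
    have "\<forall>k. \<exists>f. \<forall>x\<in>{-1..1}. ceval f x = poly (chebyshev k) x"
      by (intro allI ceval_surj continuous_intros)
    then show ?thesis using that by metis
  qed
  have T0: "T 0 = const_bcontfun 1"
    by (rule ceval_eqI) (simp add: T, simp add: ceval_def const_bcontfun.rep_eq)
  have ceval_linear: "linear (\<lambda>f. ceval f x)" for x
    unfolding ceval_def by (intro bounded_linear.linear bounded_linear_apply_bcontfun)
  have u_T: "u m = (\<Sum>k=0..d. U k m *\<^sub>R T k)" if "m \<in> {1..M}" for m
    by (rule ceval_eqI)
      (simp add: assms(7)[OF that] linear_sum[OF ceval_linear] linear_scale[OF ceval_linear] T)
  \<comment> \<open>The witnesses are the moment vectors of the two Jordan parts. Since
    \<open>S > d\<close> gives \<open>S > 0\<close>, entry 0 exists, and by \<open>T0\<close> it is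
    the mass of the respective part.\<close>
  have jordan: "\<exists>vp vm. vp \<in> carrier_vec S \<and> vm \<in> carrier_vec S \<and>
      psd (toep S vp) \<and> psd (toep S vm) \<and> (\<forall>k<S. vp $ k - vm $ k = \<phi> (T k)) \<and>
      vp $ 0 + vm $ 0 \<le> C"
    if lin: "linear \<phi>" and bnd: "\<And>f. \<bar>\<phi> f\<bar> \<le> C * norm f" and C: "C \<ge> 0"
    for \<phi> :: "cfun \<Rightarrow> real" and C
  proof -
    obtain \<phi>p \<phi>m where p: "linear \<phi>p" "linear \<phi>m"
      "\<And>f. nonneg f \<Longrightarrow> \<phi>p f \<ge> 0"
      "\<And>f. nonneg f \<Longrightarrow> \<phi>m f \<ge> 0"
      "\<And>f. \<phi> f = \<phi>p f - \<phi>m f"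
      "\<phi>p (const_bcontfun 1) + \<phi>m (const_bcontfun 1) \<le> C"
      using jordan_decomposition_functional[OF lin bnd C] by blast
    show ?thesis
      using psd_toep_moments[OF p(1,3) T, of S] psd_toep_moments[OF p(2,4) T, of S] p(5,6)
        \<open>S > d\<close> T0
      by (intro exI[of _ "Matrix.vec S (\<lambda>k. \<phi>p (T k))"] exI[of _ "Matrix.vec S (\<lambda>k. \<phi>m (T k))"])
        auto
  qed

  \<comment> \<open>Dual functionals and coordinates with respect to the basis\<close>
  have "\<exists>\<mu>. \<forall>m\<in>{1..M}. bounded_linear (\<mu> m) \<and> (\<forall>m'\<in>{1..M}. \<mu> m (u m') = (if m = m' then 1 else (0::real)))"
  proof (intro bchoice ballI)
    fix m assume m: "m \<in> {1..M}"
    obtain \<mu> where \<mu>: "bounded_linear \<mu>" "\<mu> (u m) = (1::real)"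
      "\<And>c. c \<in> ?B \<Longrightarrow> c \<noteq> u m \<Longrightarrow> \<mu> c = 0"
      using bounded_dual_functional[of ?B "u m"] assms(5) m by auto
    \<comment> \<open>Injectivity of \<open>u\<close> turns distinct indices into distinct basis
      elements.\<close>
    have "\<mu> (u m') = (if m = m' then 1 else 0)" if "m' \<in> {1..M}" for m'
      using \<mu>(2) \<mu>(3)[of "u m'"] inj_on_eq_iff[OF assms(4) that m] that by auto
    then show "\<exists>\<mu>. bounded_linear \<mu> \<and> (\<forall>m'\<in>{1..M}. \<mu> (u m') = (if m = m' then 1 else (0::real)))"
      using \<mu>(1) by blast
  qed
  then obtain \<mu> where \<mu>: "\<And>m. m \<in> {1..M} \<Longrightarrow> bounded_linear (\<mu> m)"
    "\<And>m m'. m \<in> {1..M} \<Longrightarrow> m' \<in> {1..M} \<Longrightarrow> \<mu> m (u m') = (if m = m' then 1 else (0::real))"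
    by blast
  have expand: "f = (\<Sum>m\<in>{1..M}. \<mu> m f *\<^sub>R u m)" if "f \<in> \<U>" for f
  proof -
    have lin: "linear (\<lambda>f. \<Sum>m\<in>{1..M}. \<mu> m f *\<^sub>R u m)"
      by (intro bounded_linear.linear bounded_linear_sum bounded_linear_scaleR_const \<mu>(1))
    have "f = (\<lambda>f. \<Sum>m\<in>{1..M}. \<mu> m f *\<^sub>R u m) f"
    proof (rule linear_eq_on_span[OF linear_ident lin, of ?B])
      fix b assume "b \<in> ?B"
      then obtain m where m: "m \<in> {1..M}" "b = u m" by blast
      have "(\<Sum>m'\<in>{1..M}. \<mu> m' b *\<^sub>R u m') = (\<Sum>m'\<in>{1..M}. if m' = m then u m' else 0)"
        using m by (intro sum.cong refl) (simp add: \<mu>(2))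
      then show "b = (\<Sum>m'\<in>{1..M}. \<mu> m' b *\<^sub>R u m')" using m by simp
    qed (use that assms(6) in simp)
    then show ?thesis .
  qed

  \<comment> \<open>From a projection to a feasible point\<close>
  have bound: "Inf ?E \<le> ereal (onorm P)" if "projection_onto \<U> P" for P
  proof -
    have P: "bounded_linear P" "range P = \<U>" "\<And>f. f \<in> \<U> \<Longrightarrow> P f = f"
      using that by (auto simp: projection_onto_def)
    \<comment> \<open>The plus and minus vectors are packed into a pair so that a single choice
      yields both families.\<close>
    have "\<forall>m\<in>{1..M}. \<exists>y. fst y \<in> carrier_vec S \<and> snd y \<in> carrier_vec S \<and>
      psd (toep S (fst y)) \<and> psd (toep S (snd y)) \<and>
      (\<forall>k<S. fst y $ k - snd y $ k = \<mu> m (P (T k)))"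
    proof
      fix m assume "m \<in> {1..M}"
      then have b: "bounded_linear (\<lambda>f. \<mu> m (P f))"
        by (intro bounded_linear_compose[OF \<mu>(1) P(1)])
      show "\<exists>y. fst y \<in> carrier_vec S \<and> snd y \<in> carrier_vec S \<and>
        psd (toep S (fst y)) \<and> psd (toep S (snd y)) \<and>
        (\<forall>k<S. fst y $ k - snd y $ k = \<mu> m (P (T k)))"
        using jordan[OF bounded_linear.linear[OF b] onorm[OF b, simplified] onorm_pos_le[OF b]]
        by fastforce
    qed
    then obtain y where y: "\<And>m. m \<in> {1..M} \<Longrightarrow> fst (y m) \<in> carrier_vec S \<and> snd (y m) \<in> carrier_vec S \<and>
      psd (toep S (fst (y m))) \<and> psd (toep S (snd (y m))) \<and>
      (\<forall>k<S. fst (y m) $ k - snd (y m) $ k = \<mu> m (P (T k)))"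
      by metis
    \<comment> \<open>Here the mass bound is kept, since the objective involves the \<open>z\<close>
      vectors: evaluation after \<open>P\<close> has norm at most \<open>onorm P\<close>.\<close>
    have "\<forall>l. \<exists>z. fst z \<in> carrier_vec S \<and> snd z \<in> carrier_vec S \<and>
      psd (toep S (fst z)) \<and> psd (toep S (snd z)) \<and>
      (\<forall>k<S. fst z $ k - snd z $ k = ceval (P (T k)) (cos (\<theta> l))) \<and>
      fst z $ 0 + snd z $ 0 \<le> onorm P"
    proof
      fix l
      have lin: "linear (\<lambda>f. ceval (P f) (cos (\<theta> l)))"
        using linear_compose[OF bounded_linear.linear[OF P(1)] ceval_linear] by (simp add: o_def)
      have "\<bar>ceval (P f) (cos (\<theta> l))\<bar> \<le> onorm P * norm f" for f
        using norm_bounded[of "P f" "cdomain_of_real (cos (\<theta> l))"] onorm[OF P(1), of f]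
        by (simp add: ceval_def)
      from jordan[OF lin this onorm_pos_le[OF P(1)]]
      show "\<exists>z. fst z \<in> carrier_vec S \<and> snd z \<in> carrier_vec S \<and>
        psd (toep S (fst z)) \<and> psd (toep S (snd z)) \<and>
        (\<forall>k<S. fst z $ k - snd z $ k = ceval (P (T k)) (cos (\<theta> l))) \<and>
        fst z $ 0 + snd z $ 0 \<le> onorm P" by fastforce
    qed
    then obtain z where z: "\<And>l. fst (z l) \<in> carrier_vec S \<and> snd (z l) \<in> carrier_vec S \<and>
      psd (toep S (fst (z l))) \<and> psd (toep S (snd (z l))) \<and>
      (\<forall>k<S. fst (z l) $ k - snd (z l) $ k = ceval (P (T k)) (cos (\<theta> l))) \<and>
      fst (z l) $ 0 + snd (z l) $ 0 \<le> onorm P"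
      by metis
    have dual: "(\<Sum>k=0..d. U k m' * (fst (y m) $ k - snd (y m) $ k)) = (if m = m' then 1 else 0)"
      if m: "m \<in> {1..M}" and m': "m' \<in> {1..M}" for m m'
    proof -
      have lin: "linear (\<lambda>f. \<mu> m (P f))"
        using m by (intro bounded_linear.linear bounded_linear_compose[OF \<mu>(1) P(1)])
      \<comment> \<open>All indices satisfy \<open>k \<le> d < S\<close>, so every coefficient of
        \<open>u m'\<close> meets an available moment; the sum then reassembles
        \<open>P (u m')\<close>.\<close>
      have "(\<Sum>k=0..d. U k m' * (fst (y m) $ k - snd (y m) $ k)) = (\<Sum>k=0..d. U k m' * \<mu> m (P (T k)))"
        using y[OF m] \<open>S > d\<close> by (intro sum.cong refl) auto
      also have "\<dots> = \<mu> m (P (u m'))"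
        by (simp add: u_T[OF m'] linear_sum[OF lin] linear_scale[OF lin])
      also have "P (u m') = u m'"
        using m' assms(6) by (intro P(3)) (auto intro: span_base)
      finally show ?thesis using \<mu>(2)[OF m m'] by simp
    qed
    have interp: "finsum_vec TYPE(real) S (\<lambda>m. ceval (u m) (cos (\<theta> l)) \<cdot>\<^sub>v (fst (y m) - snd (y m))) {1..M}
        = fst (z l) - snd (z l)" for l
    proof -
      let ?v = "\<lambda>m. ceval (u m) (cos (\<theta> l)) \<cdot>\<^sub>v (fst (y m) - snd (y m))"
      have v: "?v \<in> {1..M} \<rightarrow> carrier_vec S"
      proof
        fix m assume "m \<in> {1..M}"
        from y[OF this] show "?v m \<in> carrier_vec S"
          by simp
      qed
      have dim: "dim_vec (fst (z l)) = S" "dim_vec (snd (z l)) = S"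
        using z[of l] by (auto dest: carrier_vecD)
      show ?thesis
      proof (rule eq_vecI)
        show "dim_vec (finsum_vec TYPE(real) S ?v {1..M}) = dim_vec (fst (z l) - snd (z l))"
          using carrier_vecD[OF finsum_vec_closed[OF v]] dim by simp
        fix k assume "k < dim_vec (fst (z l) - snd (z l))"
        then have k: "k < S" using dim by simp
        have "finsum_vec TYPE(real) S ?v {1..M} $ k = (\<Sum>m\<in>{1..M}. ?v m $ k)"
          by (rule index_finsum_vec[OF _ k v]) simp
        also have "\<dots> = (\<Sum>m\<in>{1..M}. \<mu> m (P (T k)) * ceval (u m) (cos (\<theta> l)))"
        proof (rule sum.cong[OF refl])
          fix m assume "m \<in> {1..M}"
          from y[OF this] have "dim_vec (fst (y m)) = S" "dim_vec (snd (y m)) = S"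
            "fst (y m) $ k - snd (y m) $ k = \<mu> m (P (T k))"
            using k by (auto dest: carrier_vecD)
          then show "?v m $ k = \<mu> m (P (T k)) * ceval (u m) (cos (\<theta> l))"
            using k by simp
        qed
        \<comment> \<open>The moments \<open>\<mu> m (P (T k))\<close> are the coordinates of
          \<open>P (T k)\<close>, which lies in the range of \<open>P\<close>, so
          \<open>expand\<close> applies.\<close>
        also have "\<dots> = ceval (\<Sum>m\<in>{1..M}. \<mu> m (P (T k)) *\<^sub>R u m) (cos (\<theta> l))"
          by (simp add: linear_sum[OF ceval_linear] linear_scale[OF ceval_linear])
        also have "\<dots> = ceval (P (T k)) (cos (\<theta> l))"
          using expand[of "P (T k)"] P(2) by auto
        also have "\<dots> = (fst (z l) - snd (z l)) $ k"
        proof -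
          have "ceval (P (T k)) (cos (\<theta> l)) = fst (z l) $ k - snd (z l) $ k"
            using z[of l] k by metis
          then show ?thesis using k dim by simp
        qed
        finally show "finsum_vec TYPE(real) S ?v {1..M} $ k = (fst (z l) - snd (z l)) $ k" .
      qed
    qed
    have "ereal (MAX l\<in>{1..L}. fst (z l) $ 0 + snd (z l) $ 0) \<in> ?E"
      using y z dual interp
      by (intro CollectI exI[of _ "fst \<circ> y"] exI[of _ "snd \<circ> y"] exI[of _ "fst \<circ> z"] exI[of _ "snd \<circ> z"])
        simp
    then have "Inf ?E \<le> ereal (MAX l\<in>{1..L}. fst (z l) $ 0 + snd (z l) $ 0)"
      by (rule Inf_lower)
    \<comment> \<open>\<open>L \<ge> 1\<close> makes the maximum range over a nonempty finite set,
      so the bound on each term suffices.\<close>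
    also have "\<dots> \<le> ereal (onorm P)"
      using z \<open>L \<ge> 1\<close> by simp
    finally show ?thesis .
  qed
  \<comment> \<open>The infimum in \<open>projection_constant\<close> is real-valued, hence junk if there were no projection.\<close>
  have "{P. projection_onto \<U> P} \<noteq> {}"
  proof -
    obtain P where P: "bounded_linear P" "range P \<subseteq> span ?B" "\<And>f. f \<in> span ?B \<Longrightarrow> P f = f"
      using bounded_projection_onto_span[of ?B] by auto
    have "range P = \<U>"
      using P(2,3) unfolding assms(6) by (metis rangeI subsetI subset_antisym)
    then have "projection_onto \<U> P"
      using P(1) P(3)[unfolded assms(6)] by (simp add: projection_onto_def)
    then show ?thesis by blast
  qed
  moreover have "bdd_below (onorm ` {P. projection_onto \<U> P})"
    by (rule bdd_belowI2[of _ 0]) (simp add: projection_onto_def onorm_pos_le)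
  \<comment> \<open>Nonemptiness and the lower bound 0 on the norms let \<open>ereal\<close> commute
    with the real infimum.\<close>
  ultimately have "ereal (projection_constant \<U>) =
      (INF r\<in>onorm ` {P. projection_onto \<U> P}. ereal r)"
    unfolding projection_constant_def by (intro ereal_Inf') blast+
  moreover have "Inf ?E \<le> (INF r\<in>onorm ` {P. projection_onto \<U> P}. ereal r)"
  proof (rule INF_greatest)
    fix r assume "r \<in> onorm ` {P. projection_onto \<U> P}"
    then show "Inf ?E \<le> ereal r" using bound by blast
  qed
  ultimately show ?thesis by (simp only:)
qed

end
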